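(* Let $\alpha=(\alpha_1,\dots,\alpha_\ell)$ be a composition of $n$, let $\mathfrak{p}\subseteq\mathfrak{gl}_n(\mathbb{C})$ be the algebra of block upper triangular matrices with block size vector $\alpha$, and let $P$ be its group of invertible elements. For every $r\in\mathfrak{p}$, there exists at least one matrix in Jordan $P$-semicanonical form in the orbit $\{brb^{-1} : b\in P\}$.
   Context: A composition of $n$ is a sequence of positive integers with sum $n$; block upper triangular with block size vector $\alpha$ means that the diagonal blocks have sizes $\alpha_1,\dots,\alpha_\ell$. A matrix $M\in\mathfrak{p}$ is in Jordan $P$-semicanonical form if there is a set partition $\mathbf{a}^{(1)}\sqcup\mathbf{a}^{(2)}\sqcup\dots\sqcup\mathbf{a}^{(k)}=\{1,2,\dots,n\}$ into nonempty sets such that: (1) if $j\ne j'$, then $M_{aa'}=0$ for all $a\in\mathbf{a}^{(j)}$ and $a'\in\mathbf{a}^{(j')}$; (2) the diagonal blocks of $M$ (of sizes $\alpha_1,\dots,\alpha_\ell$) are in Jordan canonical form; (3) if $M_{aa}\ne M_{a'a'}$ for $a\in\mathbf{a}^{(j)}$ and $a'\in\mathbf{a}^{(j')}$, then $j\ne j'$. *)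

theory Defs
  imports
    "Jordan_Normal_Form.Jordan_Normal_Form"
    "HOL-Algebra.Ring"
    "HOL-Library.Disjoint_Sets"
begin

text \<open>Matrix indices are 0-based, following the matrix library: rows and columns of an
  \<open>n \<times> n\<close> matrix are indexed by \<open>{0..<n}\<close>, and the parts of a composition by \<open>{0..<length \<alpha>}\<close>.\<close>

definition composition :: "nat list \<Rightarrow> nat \<Rightarrow> bool" where
  "composition \<alpha> n \<longleftrightarrow> (\<forall>a \<in> set \<alpha>. 0 < a) \<and> sum_list \<alpha> = n"

text \<open>The interval of row (equivalently, column) indices meeting the \<open>k\<close>-th diagonal block.\<close>

definition block_indices :: "nat list \<Rightarrow> nat \<Rightarrow> nat set" where
  "block_indices \<alpha> k = {sum_list (take k \<alpha>) ..< sum_list (take (Suc k) \<alpha>)}"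

definition block_upper_triangular :: "nat list \<Rightarrow> 'a :: zero mat \<Rightarrow> bool" where
  "block_upper_triangular \<alpha> M \<longleftrightarrow>
     (\<forall>k < length \<alpha>. \<forall>l < k. \<forall>i \<in> block_indices \<alpha> k. \<forall>j \<in> block_indices \<alpha> l. M $$ (i, j) = 0)"

definition diagonal_block :: "nat list \<Rightarrow> 'a mat \<Rightarrow> nat \<Rightarrow> 'a mat" where
  "diagonal_block \<alpha> M k =
     (let s = sum_list (take k \<alpha>) in mat (\<alpha> ! k) (\<alpha> ! k) (\<lambda>(i, j). M $$ (s + i, s + j)))"

text \<open>The algebra of block upper triangular matrices, as a subring of \<open>gl\<^sub>n(\<complex>)\<close>. Its group of
  invertible elements is \<open>Units (parabolic_algebra \<alpha>)\<close>: the inverse is taken inside the algebra.\<close>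

definition parabolic_algebra :: "nat list \<Rightarrow> complex mat ring" where
  "parabolic_algebra \<alpha> =
     (ring_mat TYPE(complex) (sum_list \<alpha>) ())
       \<lparr>carrier := {M \<in> carrier_mat (sum_list \<alpha>) (sum_list \<alpha>). block_upper_triangular \<alpha> M}\<rparr>"

text \<open>A matrix that \<^emph>\<open>is\<close> in Jordan canonical form; the library's \<open>jordan_nf\<close> only says that it is
  similar to one. The Jordan blocks (ones on the superdiagonal) may come in any order.\<close>

definition in_jordan_form :: "complex mat \<Rightarrow> bool" where
  "in_jordan_form A \<longleftrightarrow> (\<exists>n_as. 0 \<notin> fst ` set n_as \<and> A = jordan_matrix n_as)"

definition jordan_semicanonical :: "nat list \<Rightarrow> complex mat \<Rightarrow> bool" where
  "jordan_semicanonical \<alpha> M \<longleftrightarrow>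
     M \<in> carrier (parabolic_algebra \<alpha>) \<and>
     (\<exists>\<A>. partition_on {0..<sum_list \<alpha>} \<A> \<and>
        (\<forall>A \<in> \<A>. \<forall>A' \<in> \<A>. A \<noteq> A' \<longrightarrow> (\<forall>a \<in> A. \<forall>a' \<in> A'. M $$ (a, a') = 0)) \<and>
        (\<forall>k < length \<alpha>. in_jordan_form (diagonal_block \<alpha> M k)) \<and>
        (\<forall>A \<in> \<A>. \<forall>A' \<in> \<A>. \<forall>a \<in> A. \<forall>a' \<in> A'. M $$ (a, a) \<noteq> M $$ (a', a') \<longrightarrow> A \<noteq> A'))"

end

theory Submission
  imports Defs "Jordan_Normal_Form.Jordan_Normal_Form_Existence"
begin

text \<open>Conjugating by a block diagonal matrix puts the diagonal blocks into Jordan form, which makes the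
  whole matrix upper triangular. A nonzero entry \<open>(i, j)\<close> with different diagonal entries in rows \<open>i\<close>
  and \<open>j\<close> is then removed by conjugating with \<open>1 + c E\<^sub>i\<^sub>j\<close>, which only affects row \<open>i\<close> from column \<open>j\<close>
  on and column \<open>j\<close> up to row \<open>i\<close>. Going through the columns from left to right, and upwards within
  each column, earlier zeros persist; the diagonal blocks persist because Jordan matrices have no
  such entries. The classes of indices with equal diagonal entries form the required partition.\<close>

section \<open>Staircase zero patterns\<close>

text \<open>With \<open>T = UNIV\<close> this is upper triangularity; with \<open>T\<close> the partial sums of \<open>\<alpha>\<close> it is block upper
  triangularity.\<close>

definition staircase :: "nat set \<Rightarrow> 'a :: zero mat \<Rightarrow> bool" where
  "staircase T A \<longleftrightarrow> (\<forall>t \<in> T. \<forall>i j. j < t \<longrightarrow> t \<le> i \<longrightarrow> i < dim_row A \<longrightarrow> A $$ (i, j) = 0)"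

lemma staircaseD:
  "staircase T A \<Longrightarrow> t \<in> T \<Longrightarrow> j < t \<Longrightarrow> t \<le> i \<Longrightarrow> i < dim_row A \<Longrightarrow> A $$ (i, j) = 0"
  by (auto simp: staircase_def)

lemma staircase_mono: "staircase T A \<Longrightarrow> S \<subseteq> T \<Longrightarrow> staircase S A"
  by (auto simp: staircase_def)

lemma staircase_UNIV: "staircase UNIV A \<longleftrightarrow> upper_triangular A"
  unfolding staircase_def upper_triangular_def using order_less_le_trans by blast

text \<open>For \<open>j < t \<le> i\<close>, every summand \<open>A $$ (i, m) * B $$ (m, j)\<close>
  vanishes: its first factor if \<open>m < t\<close>, its second otherwise. This one argument serves
  upper triangular and block upper triangular matrices alike.\<close>

lemma staircase_mult:
  fixes A B :: "'a :: semiring_0 mat"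
  assumes A: "A \<in> carrier_mat n n" "staircase T A"
    and B: "B \<in> carrier_mat n n" "staircase T B"
  shows "staircase T (A * B)"
  unfolding staircase_def
proof (intro ballI allI impI)
  fix t i j assume t: "t \<in> T" and ij: "j < t" "t \<le> i" "i < dim_row (A * B)"
  have "A $$ (i, m) * B $$ (m, j) = 0" if "m < n" for m
    using staircaseD[OF A(2) t, of m i] staircaseD[OF B(2) t, of j m] A(1) B(1) ij that
    by (cases "m < t") auto
  then show "(A * B) $$ (i, j) = 0"
    using A(1) B(1) ij by (auto simp: scalar_prod_def intro!: sum.neutral)
qed

section \<open>Block upper triangularity as a staircase condition\<close>

definition partial_sums :: "nat list \<Rightarrow> nat set" where
  "partial_sums \<alpha> = (\<lambda>k. sum_list (take k \<alpha>)) ` {..length \<alpha>}"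

lemma partial_sums_Cons: "partial_sums (a # \<alpha>) = insert 0 ((+) a ` partial_sums \<alpha>)"
  by (auto simp: partial_sums_def atMost_Suc_eq_insert_0 image_image)

lemma zero_in_partial_sums: "0 \<in> partial_sums \<alpha>"
  unfolding partial_sums_def by (rule image_eqI[of _ _ 0]) auto

lemma sum_list_take_mono: "k \<le> l \<Longrightarrow> sum_list (take k \<alpha>) \<le> sum_list (take l (\<alpha> :: nat list))"
  by (auto simp: le_iff_add take_add)

lemma ex_block_index:
  "i < sum_list \<alpha> \<Longrightarrow> \<exists>k < length \<alpha>. i \<in> block_indices \<alpha> k"
proof (induction \<alpha> arbitrary: i)
  case (Cons a \<alpha>)
  show ?case
  proof (cases "i < a")
    case True
    then show ?thesis by (intro exI[of _ 0]) (auto simp: block_indices_def)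
  next
    case False
    then have "i - a < sum_list \<alpha>" using Cons.prems by auto
    then obtain k where "k < length \<alpha>" "i - a \<in> block_indices \<alpha> k" using Cons.IH by blast
    then show ?thesis using False by (intro exI[of _ "Suc k"]) (auto simp: block_indices_def)
  qed
qed simp

text \<open>A boundary between column \<open>j\<close> and row \<open>i\<close> puts them into
  different blocks; conversely, the start of the row's block is a boundary beyond every column of an
  earlier block. Thresholds suit products and induction on the composition better than pairs of
  blocks.\<close>

lemma block_upper_triangular_iff:
  assumes M: "M \<in> carrier_mat (sum_list \<alpha>) (sum_list \<alpha>)"
  shows "block_upper_triangular \<alpha> M \<longleftrightarrow> staircase (partial_sums \<alpha>) M"
proof
  assume bu: "block_upper_triangular \<alpha> M"
  show "staircase (partial_sums \<alpha>) M"
    unfolding staircase_def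
  proof (intro ballI allI impI)
    fix t i j assume "t \<in> partial_sums \<alpha>" and ij: "j < t" "t \<le> i" "i < dim_row M"
    then obtain k where t: "t = sum_list (take k \<alpha>)" by (auto simp: partial_sums_def)
    have "i < sum_list \<alpha>" using ij M by auto
    then obtain k' l' where k': "k' < length \<alpha>" "i \<in> block_indices \<alpha> k'"
      and l': "l' < length \<alpha>" "j \<in> block_indices \<alpha> l'"
      using ex_block_index[of i \<alpha>] ex_block_index[of j \<alpha>] ij by auto
    \<comment> \<open>Otherwise the start of block \<open>l'\<close>, which is at most
      \<open>j\<close>, would be at least \<open>t\<close>. The bound on \<open>k'\<close> is the
      mirror image, with the end of block \<open>k'\<close>.\<close>
    have "l' < k"
      using sum_list_take_mono[of k l' \<alpha>] l' ij t by (force simp: block_indices_def)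
    moreover have "k \<le> k'"
      using sum_list_take_mono[of "Suc k'" k \<alpha>] k' ij t by (force simp: block_indices_def)
    ultimately show "M $$ (i, j) = 0"
      using bu k' l' less_le_trans unfolding block_upper_triangular_def by blast
  qed
next
  assume st: "staircase (partial_sums \<alpha>) M"
  show "block_upper_triangular \<alpha> M"
    unfolding block_upper_triangular_def
  proof (intro allI impI ballI)
    fix k l i j
    assume kl: "k < length \<alpha>" "l < k" and i: "i \<in> block_indices \<alpha> k" and j: "j \<in> block_indices \<alpha> l"
    have "sum_list (take k \<alpha>) \<in> partial_sums \<alpha>" using kl by (auto simp: partial_sums_def)
    moreover have "j < sum_list (take k \<alpha>)"
      using sum_list_take_mono[of "Suc l" k \<alpha>] kl j by (auto simp: block_indices_def)
    moreover have "sum_list (take (Suc k) \<alpha>) \<le> sum_list \<alpha>"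
      using sum_list_take_mono[of "Suc k" "length \<alpha>" \<alpha>] kl by simp
    ultimately show "M $$ (i, j) = 0"
      using staircaseD[OF st, of "sum_list (take k \<alpha>)" j i] i M by (auto simp: block_indices_def)
  qed
qed

section \<open>Splitting off the first block\<close>

lemma staircase_four_block:
  assumes "A \<in> carrier_mat a a" "B \<in> carrier_mat a m" "D \<in> carrier_mat m m"
    and "staircase (partial_sums \<alpha>) D"
  shows "staircase (partial_sums (a # \<alpha>)) (four_block_mat A B (0\<^sub>m m a) D)"
  unfolding staircase_def
proof (intro ballI allI impI)
  fix t i j
  assume t: "t \<in> partial_sums (a # \<alpha>)" and ij: "j < t" "t \<le> i"
    "i < dim_row (four_block_mat A B (0\<^sub>m m a) D)"
  \<comment> \<open>\<open>j < t\<close> excludes \<open>t = 0\<close>, so \<open>t\<close> is a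
    boundary of the tail shifted by \<open>a\<close>. Row \<open>i\<close> is then in the lower
    half, where columns left of \<open>a\<close> meet the zero block.\<close>
  then obtain u where u: "u \<in> partial_sums \<alpha>" "t = a + u" by (auto simp: partial_sums_Cons)
  show "four_block_mat A B (0\<^sub>m m a) D $$ (i, j) = 0"
    using staircaseD[OF assms(4) u(1), of "j - a" "i - a"] assms(1-3) ij u(2) by auto
qed

text \<open>The boundary \<open>a\<close> forces the lower left block to vanish, and the boundaries
  \<open>a + t\<close> become the boundaries \<open>t\<close> of \<open>D\<close>.\<close>

lemma staircase_split:
  assumes M: "M \<in> carrier_mat (a + m) (a + m)" and st: "staircase (partial_sums (a # \<alpha>)) M"
  obtains A B D where "A \<in> carrier_mat a a" "B \<in> carrier_mat a m" "D \<in> carrier_mat m m"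
    "M = four_block_mat A B (0\<^sub>m m a) D" "staircase (partial_sums \<alpha>) D"
proof -
  obtain A B C D where "split_block M a a = (A, B, C, D)" by (metis prod_cases4)
  from split_block[OF this, of m m] M
  have c: "A \<in> carrier_mat a a" "B \<in> carrier_mat a m" "C \<in> carrier_mat m a" "D \<in> carrier_mat m m"
    and eq: "M = four_block_mat A B C D" by auto
  have "C = 0\<^sub>m m a"
  proof (rule eq_matI)
    fix i j assume ij: "i < dim_row (0\<^sub>m m a)" "j < dim_col (0\<^sub>m m a)"
    have "a \<in> partial_sums (a # \<alpha>)" using zero_in_partial_sums by (force simp: partial_sums_Cons)
    then have "M $$ (i + a, j) = 0" using staircaseD[OF st, of a j "i + a"] M ij by auto
    then show "C $$ (i, j) = 0\<^sub>m m a $$ (i, j)" unfolding eq using c ij by auto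
  qed (use c in auto)
  moreover have "staircase (partial_sums \<alpha>) D"
    unfolding staircase_def
  proof (intro ballI allI impI)
    fix t i j assume t: "t \<in> partial_sums \<alpha>" and ij: "j < t" "t \<le> i" "i < dim_row D"
    then have "M $$ (a + i, a + j) = 0"
      using staircaseD[OF st, of "a + t" "a + j" "a + i"] M c by (auto simp: partial_sums_Cons)
    then show "D $$ (i, j) = 0" unfolding eq using c ij by auto
  qed
  ultimately show ?thesis using that c eq by blast
qed

lemma diagonal_block_four_block:
  assumes "A \<in> carrier_mat a a" "B \<in> carrier_mat a (sum_list \<alpha>)"
    and "D \<in> carrier_mat (sum_list \<alpha>) (sum_list \<alpha>)"
  shows "diagonal_block (a # \<alpha>) (four_block_mat A B C D) 0 = A"
    and "k < length \<alpha> \<Longrightarrow>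
      diagonal_block (a # \<alpha>) (four_block_mat A B C D) (Suc k) = diagonal_block \<alpha> D k"
proof -
  show "diagonal_block (a # \<alpha>) (four_block_mat A B C D) 0 = A"
    unfolding diagonal_block_def Let_def by (rule eq_matI) (use assms in auto)
  assume k: "k < length \<alpha>"
  have "sum_list (take k \<alpha>) + \<alpha> ! k = sum_list (take (Suc k) \<alpha>)"
    using k by (simp add: take_Suc_conv_app_nth)
  also have "\<dots> \<le> sum_list \<alpha>"
    using sum_list_take_mono[of "Suc k" "length \<alpha>" \<alpha>] k by simp
  finally show "diagonal_block (a # \<alpha>) (four_block_mat A B C D) (Suc k) = diagonal_block \<alpha> D k"
    unfolding diagonal_block_def Let_def by (intro eq_matI) (use assms in auto)
qed

section \<open>Jordan form of the diagonal blocks\<close>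

text \<open>Over the complex numbers the characteristic polynomial splits, so a Jordan normal form
  exists. The witness is oriented so that \<open>J = P * A * Q\<close>.\<close>

lemma in_jordan_form_similar:
  fixes A :: "complex mat"
  assumes A: "A \<in> carrier_mat n n"
  obtains J P Q where "in_jordan_form J" "similar_mat_wit J A P Q"
proof -
  obtain as where "char_poly A = (\<Prod>a\<leftarrow>as. [:- a, 1:])" using char_poly_factorized[OF A] by blast
  then obtain n_as where "jordan_nf A n_as" using jordan_nf_exists[OF A] by blast
  then show ?thesis
    using that similar_mat_wit_sym unfolding jordan_nf_def similar_mat_def in_jordan_form_def by blast
qed

lemma in_jordan_form_upper_triangular: "in_jordan_form J \<Longrightarrow> upper_triangular J"
  by (auto simp: in_jordan_form_def jordan_matrix_upper_triangular)

text \<open>Within one Jordan block the diagonal is constant, and between two Jordan blocks all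
  entries are zero. Hence the elimination finds nothing to remove inside a diagonal block in Jordan
  form.\<close>

lemma jordan_matrix_off_diagonal:
  assumes "i < sum_list (map fst n_as)" "j < sum_list (map fst n_as)"
    and "jordan_matrix n_as $$ (i, i) \<noteq> jordan_matrix n_as $$ (j, j)"
  shows "jordan_matrix n_as $$ (i, j) = 0"
  using assms
proof (induction n_as arbitrary: i j)
  case (Cons na n_as)
  obtain m a where na: "na = (m, a)" by force
  show ?case
    using Cons.prems Cons.IH[of "i - m" "j - m"] unfolding na jordan_matrix_Cons
    by (auto split: if_splits)
qed simp

text \<open>Induction on the composition, with a block diagonal \<open>P\<close> assembled from one
  Jordan base change per block. Such a \<open>P\<close> and its inverse respect the block pattern,
  and the result is upper triangular because Jordan matrices are.\<close>

lemma jordan_diagonal_blocks: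
  fixes R :: "complex mat"
  assumes "R \<in> carrier_mat (sum_list \<alpha>) (sum_list \<alpha>)" "staircase (partial_sums \<alpha>) R"
  shows "\<exists>M P Q. similar_mat_wit M R P Q \<and> staircase (partial_sums \<alpha>) P \<and>
    staircase (partial_sums \<alpha>) Q \<and> upper_triangular M \<and>
    (\<forall>k < length \<alpha>. in_jordan_form (diagonal_block \<alpha> M k))"
  using assms
proof (induction \<alpha> arbitrary: R)
  case Nil
  then show ?case
    using similar_mat_wit_refl[of R 0]
    by (intro exI[of _ R] exI[of _ "1\<^sub>m 0"]) (auto simp: staircase_def)
next
  case (Cons a \<alpha>)
  let ?m = "sum_list \<alpha>"
  have "R \<in> carrier_mat (a + ?m) (a + ?m)" using Cons.prems by simp
  then obtain A B D where c: "A \<in> carrier_mat a a" "B \<in> carrier_mat a ?m" "D \<in> carrier_mat ?m ?m"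
    and R: "R = four_block_mat A B (0\<^sub>m ?m a) D" and D: "staircase (partial_sums \<alpha>) D"
    using staircase_split[OF _ Cons.prems(2)] by blast
  obtain J P1 Q1 where J: "in_jordan_form J" and s1: "similar_mat_wit J A P1 Q1"
    using in_jordan_form_similar[OF c(1)] .
  obtain E P2 Q2 where s2: "similar_mat_wit E D P2 Q2"
    and st: "staircase (partial_sums \<alpha>) P2" "staircase (partial_sums \<alpha>) Q2"
    and E: "upper_triangular E" "\<forall>k < length \<alpha>. in_jordan_form (diagonal_block \<alpha> E k)"
    using Cons.IH[OF c(3) D] by blast
  have c1: "J \<in> carrier_mat a a" "P1 \<in> carrier_mat a a" "Q1 \<in> carrier_mat a a"
    using similar_mat_witD2[OF c(1) similar_mat_wit_sym[OF s1]] by auto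
  have c2: "E \<in> carrier_mat ?m ?m" "P2 \<in> carrier_mat ?m ?m" "Q2 \<in> carrier_mat ?m ?m"
    using similar_mat_witD2[OF c(3) similar_mat_wit_sym[OF s2]] by auto
  \<comment> \<open>The upper right corner after conjugation by the block diagonal matrix of
    \<open>P1\<close> and \<open>P2\<close>, whose inverse has the blocks \<open>Q1\<close> and
    \<open>Q2\<close>. The lower left corner \<open>P2 * 0 * Q1\<close> stays zero.\<close>
  let ?B = "P1 * B * Q2"
  have B: "?B \<in> carrier_mat a ?m" using c c1 c2 by auto
  let ?M = "four_block_mat J ?B (0\<^sub>m ?m a) E"
  let ?P = "four_block_mat P1 (0\<^sub>m a ?m) (0\<^sub>m ?m a) P2"
  let ?Q = "four_block_mat Q1 (0\<^sub>m a ?m) (0\<^sub>m ?m a) Q2"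
  have "0\<^sub>m ?m a = P2 * 0\<^sub>m ?m a * Q1" using c1 c2 by simp
  from similar_mat_wit_four_block[OF s1 s2 refl this c1(1) c2(1) _ c(2)]
  have "similar_mat_wit ?M R ?P ?Q" unfolding R by simp
  moreover have "staircase (partial_sums (a # \<alpha>)) ?P" "staircase (partial_sums (a # \<alpha>)) ?Q"
    using staircase_four_block c1 c2 st zero_carrier_mat by blast+
  moreover have "upper_triangular ?M"
    using upper_triangular_four_block[OF c1(1) c2(1)] in_jordan_form_upper_triangular[OF J] E by blast
  moreover have "in_jordan_form (diagonal_block (a # \<alpha>) ?M k)" if "k < length (a # \<alpha>)" for k
    using that J E diagonal_block_four_block[OF c1(1) B c2(1)] by (cases k) auto
  ultimately show ?case by blast
qed

section \<open>Triangular conjugations that fix separated windows\<close>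

text \<open>The window is closed at both ends. Positions with \<open>a < b\<close> are enough,
  because the predicate is combined with upper triangularity.\<close>

definition separated :: "'a :: zero mat \<Rightarrow> nat \<Rightarrow> nat \<Rightarrow> bool" where
  "separated A s e \<longleftrightarrow>
     (\<forall>a b. s \<le> a \<longrightarrow> a < b \<longrightarrow> b \<le> e \<longrightarrow> A $$ (a, a) \<noteq> A $$ (b, b) \<longrightarrow> A $$ (a, b) = 0)"

text \<open>A Jordan diagonal block is a separated window, so the last clause preserves it.\<close>

definition refines :: "nat \<Rightarrow> 'a :: semiring_1 mat \<Rightarrow> 'a mat \<Rightarrow> bool" where
  "refines n B A \<longleftrightarrow> B \<in> carrier_mat n n \<and> upper_triangular B \<and>
     (\<exists>P Q. similar_mat_wit B A P Q \<and> upper_triangular P \<and> upper_triangular Q) \<and>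
     (\<forall>i < n. B $$ (i, i) = A $$ (i, i)) \<and>
     (\<forall>s e. e < n \<longrightarrow> separated A s e \<longrightarrow>
        (\<forall>i j. s \<le> i \<longrightarrow> i \<le> e \<longrightarrow> s \<le> j \<longrightarrow> j \<le> e \<longrightarrow> B $$ (i, j) = A $$ (i, j)))"

lemma refines_carrier: "refines n B A \<Longrightarrow> B \<in> carrier_mat n n"
  and refines_upper_triangular: "refines n B A \<Longrightarrow> upper_triangular B"
  and refines_diag: "refines n B A \<Longrightarrow> i < n \<Longrightarrow> B $$ (i, i) = A $$ (i, i)"
  and refines_agree: "refines n B A \<Longrightarrow> separated A s e \<Longrightarrow> e < n \<Longrightarrow> s \<le> i \<Longrightarrow> i \<le> e \<Longrightarrow>
    s \<le> j \<Longrightarrow> j \<le> e \<Longrightarrow> B $$ (i, j) = A $$ (i, j)"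
  by (simp_all add: refines_def)

lemma refines_similar:
  assumes "refines n B A"
  obtains P Q where "similar_mat_wit B A P Q" "upper_triangular P" "upper_triangular Q"
proof -
  have "\<exists>P Q. similar_mat_wit B A P Q \<and> upper_triangular P \<and> upper_triangular Q"
    using assms by (simp add: refines_def)
  then show ?thesis using that by (elim exE conjE)
qed

lemma upper_triangular_mult:
  "A \<in> carrier_mat n n \<Longrightarrow> B \<in> carrier_mat n n \<Longrightarrow> upper_triangular A \<Longrightarrow> upper_triangular B \<Longrightarrow>
    upper_triangular (A * B :: 'a :: semiring_0 mat)"
  unfolding staircase_UNIV[symmetric] by (rule staircase_mult) auto

lemma refines_refl:
  "A \<in> carrier_mat n n \<Longrightarrow> upper_triangular A \<Longrightarrow> refines n A (A :: 'a :: semiring_1 mat)"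
  unfolding refines_def
  by (intro conjI exI[of _ "1\<^sub>m n"] similar_mat_wit_refl upper_triangular_one) auto

lemma refines_trans:
  fixes A B C :: "'a :: semiring_1 mat"
  assumes CB: "refines n C B" and BA: "refines n B A"
  shows "refines n C A"
proof -
  obtain P Q where s: "similar_mat_wit C B P Q" and PQ: "upper_triangular P" "upper_triangular Q"
    using refines_similar[OF CB] .
  obtain P' Q' where s': "similar_mat_wit B A P' Q'"
    and PQ': "upper_triangular P'" "upper_triangular Q'"
    using refines_similar[OF BA] .
  have c: "C \<in> carrier_mat n n" "B \<in> carrier_mat n n"
    using refines_carrier CB BA by blast+
  have m: "P \<in> carrier_mat n n" "Q \<in> carrier_mat n n" "P' \<in> carrier_mat n n" "Q' \<in> carrier_mat n n"
    using similar_mat_witD2[OF c(1) s] similar_mat_witD2[OF c(2) s'] by auto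
  have wit: "\<exists>P Q. similar_mat_wit C A P Q \<and> upper_triangular P \<and> upper_triangular Q"
    using similar_mat_wit_trans[OF s s'] upper_triangular_mult m PQ PQ' by blast
  have agree: "C $$ (i, j) = A $$ (i, j)"
    if w: "e < n" "separated A s e" and ij: "s \<le> i" "i \<le> e" "s \<le> j" "j \<le> e" for s e i j
  proof -
    have eq: "B $$ (a, b) = A $$ (a, b)" if "s \<le> a" "a \<le> e" "s \<le> b" "b \<le> e" for a b
      using refines_agree[OF BA w(2,1)] that by blast
    \<comment> \<open>\<open>A\<close> and \<open>B\<close> agree on the whole window, diagonal
      included, so separation passes to \<open>B\<close> and the second refinement applies to the
      same window.\<close>
    have "separated B s e" using w(2) eq unfolding separated_def by simp
    then have "C $$ (i, j) = B $$ (i, j)" using refines_agree[OF CB _ w(1)] ij by blast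
    then show ?thesis using eq ij by simp
  qed
  have "C $$ (i, i) = A $$ (i, i)" if "i < n" for i
    using refines_diag[OF CB that] refines_diag[OF BA that] by simp
  then show ?thesis
    using c(1) refines_upper_triangular[OF CB] wit agree by (simp add: refines_def)
qed

section \<open>Elimination between different diagonal values\<close>

text \<open>Conjugation by \<open>1 - c * E_ij\<close> changes entry \<open>(i, j)\<close> by
  \<open>c\<close> times the difference of two diagonal entries, so distinct diagonal entries allow
  it to be cancelled. The last clause lists the positions that must survive: earlier columns, and
  column \<open>j\<close> below row \<open>i\<close>.\<close>

lemma refines_eliminate:
  fixes A :: "'a :: field mat"
  assumes A: "A \<in> carrier_mat n n" "upper_triangular A" and ij: "i < j" "j < n"
  shows "\<exists>B. refines n B A \<and> (A $$ (i, i) \<noteq> A $$ (j, j) \<longrightarrow> B $$ (i, j) = 0) \<and>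
    (\<forall>a b. a < n \<longrightarrow> b < n \<longrightarrow> b < j \<or> b = j \<and> i < a \<longrightarrow> B $$ (a, b) = A $$ (a, b))"
proof (cases "A $$ (i, i) \<noteq> A $$ (j, j) \<and> A $$ (i, j) \<noteq> 0")
  case False
  then show ?thesis using refines_refl[OF A] by auto
next
  case True
  \<comment> \<open>The solution of \<open>A_ij + c * A_ii - c * A_jj = 0\<close>; the denominator
    is nonzero in this case.\<close>
  define c where "c = A $$ (i, j) / (A $$ (j, j) - A $$ (i, i))"
  define B where "B = add_col_sub_row c i j A"
  have lower: "A $$ (a, b) = 0" if "b < a" "a < n" for a b using A that by auto
  have idx: "B $$ (a, b) =
      (if a = i \<and> b = j then 0
       else if a = i then A $$ (a, b) - c * A $$ (j, b)
       else if b = j then A $$ (a, b) + c * A $$ (a, i) else A $$ (a, b))"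
    if "a < n" "b < n" for a b
  proof -
    have "A $$ (i, j) + c * A $$ (i, i) - c * A $$ (j, j) = 0"
    proof -
      have "c * (A $$ (j, j) - A $$ (i, i)) = A $$ (i, j)" using True by (auto simp: c_def)
      then show ?thesis by (simp add: algebra_simps)
    qed
    then show ?thesis using that A(1) ij lower[OF ij] unfolding B_def by auto
  qed
  have Bc: "B \<in> carrier_mat n n" using A unfolding B_def by simp
  \<comment> \<open>Row \<open>j\<close> is zero left of column \<open>j\<close>, so the row
    operation changes nothing there; column \<open>i\<close> is zero below row \<open>i\<close>, so
    the column operation changes nothing there.\<close>
  have keep: "B $$ (a, b) = A $$ (a, b)" if "a < n" "b < n" "\<not> (a \<le> i \<and> j \<le> b)" for a b
    using that ij by (auto simp: idx lower)
  have "upper_triangular B"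
    using Bc ij by (auto simp: upper_triangular_def keep lower)
  moreover have "\<exists>P Q. similar_mat_wit B A P Q \<and> upper_triangular P \<and> upper_triangular Q"
  proof (intro exI conjI)
    let ?P = "addrow_mat n (- c) i j" and ?Q = "addrow_mat n c i j"
    have "B = ?P * (A * ?Q)"
      unfolding B_def add_col_sub_row_def using ij A
      by (subst addcol_mat[OF A(1)], simp, subst addrow_mat[of _ n n]) auto
    also have "\<dots> = ?P * A * ?Q" using A(1) by (simp add: assoc_mult_mat[of _ n n _ n _ n])
    finally show "similar_mat_wit B A ?P ?Q"
      using addrow_mat_inv[of i n j c] addrow_mat_inv[of i n j "- c"] ij A Bc
      by (intro similar_mat_witI) auto
    show "upper_triangular ?P" "upper_triangular ?Q"
      using ij by (auto simp: upper_triangular_def)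
  qed
  moreover have "B $$ (a, b) = A $$ (a, b)"
    if "e < n" "separated A s e" "s \<le> a" "a \<le> e" "s \<le> b" "b \<le> e" for s e a b
  proof -
    \<comment> \<open>A separated window containing \<open>(i, j)\<close> would make that entry
      zero. A changed position \<open>(a, b)\<close> has \<open>a \<le> i\<close> and
      \<open>j \<le> b\<close>, so a window containing it would also contain
      \<open>(i, j)\<close>.\<close>
    have "\<not> (s \<le> i \<and> j \<le> e)" using that(2) True ij unfolding separated_def by blast
    then show ?thesis using keep that by auto
  qed
  ultimately have "refines n B A" using Bc keep ij unfolding refines_def by auto
  moreover have "B $$ (i, j) = 0" using idx[of i j] ij by simp
  moreover have "B $$ (a, b) = A $$ (a, b)" if "a < n" "b < n" "b < j \<or> b = j \<and> i < a" for a b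
    using keep[of a b] that by auto
  ultimately show ?thesis by blast
qed

text \<open>After \<open>m\<close> rounds the rows from \<open>j - m\<close> up to
  \<open>j - 1\<close> of column \<open>j\<close> are done. The order is upwards because a round can
  alter column \<open>j\<close> above the row being cleared, but not below it.\<close>

lemma refines_eliminate_column:
  fixes A :: "'a :: field mat"
  assumes A: "A \<in> carrier_mat n n" "upper_triangular A" "j < n"
    and sep: "\<And>a b. a < b \<Longrightarrow> b < j \<Longrightarrow> A $$ (a, a) \<noteq> A $$ (b, b) \<Longrightarrow> A $$ (a, b) = 0"
    and "m \<le> j"
  shows "\<exists>B. refines n B A \<and> (\<forall>a b. a < b \<longrightarrow> b < j \<or> b = j \<and> j - m \<le> a \<longrightarrow>
    B $$ (a, a) \<noteq> B $$ (b, b) \<longrightarrow> B $$ (a, b) = 0)"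
  using \<open>m \<le> j\<close>
proof (induction m)
  case 0
  then show ?case using refines_refl[OF A(1,2)] sep by auto
next
  case (Suc m)
  then obtain B where BA: "refines n B A"
    and B: "\<And>a b. a < b \<Longrightarrow> b < j \<or> b = j \<and> j - m \<le> a \<Longrightarrow>
      B $$ (a, a) \<noteq> B $$ (b, b) \<Longrightarrow> B $$ (a, b) = 0" by auto
  define i where "i = j - Suc m"
  have i: "i < j" "j - m = Suc i" using Suc.prems by (auto simp: i_def)
  have "B \<in> carrier_mat n n" "upper_triangular B"
    using refines_carrier[OF BA] refines_upper_triangular[OF BA] by auto
  then obtain C where CB: "refines n C B" and z: "B $$ (i, i) \<noteq> B $$ (j, j) \<Longrightarrow> C $$ (i, j) = 0"
    and keep: "\<And>a b. a < n \<Longrightarrow> b < n \<Longrightarrow> b < j \<or> b = j \<and> i < a \<Longrightarrow> C $$ (a, b) = B $$ (a, b)"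
    using refines_eliminate[OF _ _ i(1) A(3)] by blast
  have diag: "C $$ (a, a) = B $$ (a, a)" if "a < n" for a using refines_diag[OF CB that] .
  have "C $$ (a, b) = 0"
    if ab: "a < b" "b < j \<or> b = j \<and> i \<le> a" and ne: "C $$ (a, a) \<noteq> C $$ (b, b)" for a b
  proof (cases "a = i \<and> b = j")
    case True
    then show ?thesis using z ne diag ab A(3) by auto
  next
    case False
    then show ?thesis using B[of a b] keep[of a b] ne diag ab A(3) i by auto
  qed
  then show ?case using refines_trans[OF CB BA] unfolding i_def by blast
qed

lemma refines_separated:
  fixes A :: "'a :: field mat"
  assumes A: "A \<in> carrier_mat n n" "upper_triangular A" and "j \<le> n"
  shows "\<exists>B. refines n B A \<and>
    (\<forall>a b. a < b \<longrightarrow> b < j \<longrightarrow> B $$ (a, a) \<noteq> B $$ (b, b) \<longrightarrow> B $$ (a, b) = 0)"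
  using \<open>j \<le> n\<close>
proof (induction j)
  case 0
  then show ?case using refines_refl[OF A] by auto
next
  case (Suc j)
  then obtain B where BA: "refines n B A"
    and B: "\<And>a b. a < b \<Longrightarrow> b < j \<Longrightarrow> B $$ (a, a) \<noteq> B $$ (b, b) \<Longrightarrow> B $$ (a, b) = 0" by auto
  have "B \<in> carrier_mat n n" "upper_triangular B"
    using refines_carrier[OF BA] refines_upper_triangular[OF BA] by auto
  \<comment> \<open>With \<open>m = j\<close> the row bound \<open>j - j\<close> is zero, so the
    entire column above the diagonal is cleared.\<close>
  then obtain C where "refines n C B"
    and "\<forall>a b. a < b \<longrightarrow> b < j \<or> b = j \<and> j - j \<le> a \<longrightarrow> C $$ (a, a) \<noteq> C $$ (b, b) \<longrightarrow> C $$ (a, b) = 0"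
    using refines_eliminate_column[of B n j j] B Suc.prems by auto
  then show ?case using refines_trans[OF _ BA] by (auto simp: less_Suc_eq)
qed

section \<open>Persistence of the Jordan diagonal blocks\<close>

lemma separated_jordan_block:
  assumes "k < length \<alpha>" "in_jordan_form (diagonal_block \<alpha> M k)"
    and "s = sum_list (take k \<alpha>)"
  shows "separated M s (s + \<alpha> ! k - 1)"
  unfolding separated_def
proof (intro allI impI)
  fix a b
  assume ab: "s \<le> a" "a < b" "b \<le> s + \<alpha> ! k - 1" and ne: "M $$ (a, a) \<noteq> M $$ (b, b)"
  let ?D = "diagonal_block \<alpha> M k"
  obtain n_as where J: "?D = jordan_matrix n_as" using assms(2) by (auto simp: in_jordan_form_def)
  have "sum_list (map fst n_as) = dim_row ?D" unfolding J by simp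
  then have dim: "sum_list (map fst n_as) = \<alpha> ! k" by (simp add: diagonal_block_def Let_def)
  have idx: "jordan_matrix n_as $$ (i, j) = M $$ (s + i, s + j)" if "i < \<alpha> ! k" "j < \<alpha> ! k" for i j
    unfolding J[symmetric] using that assms(3) by (simp add: diagonal_block_def Let_def)
  \<comment> \<open>\<open>s \<le> a < b\<close> rules out an empty block, for which the subtraction
    in the window's right end could truncate.\<close>
  have lt: "a - s < \<alpha> ! k" "b - s < \<alpha> ! k" using ab by auto
  show "M $$ (a, b) = 0"
    using jordan_matrix_off_diagonal[of "a - s" n_as "b - s"] idx lt dim ne ab by simp
qed

text \<open>A block in Jordan form occupies a separated window of \<open>A\<close>, and a refinement
  agrees with \<open>A\<close> on such windows.\<close>

lemma diagonal_block_refines: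
  assumes ref: "refines n B A" and n: "n = sum_list \<alpha>" and k: "k < length \<alpha>"
    and J: "in_jordan_form (diagonal_block \<alpha> A k)"
  shows "diagonal_block \<alpha> B k = diagonal_block \<alpha> A k"
proof -
  let ?s = "sum_list (take k \<alpha>)"
  have "?s + \<alpha> ! k = sum_list (take (Suc k) \<alpha>)"
    using k by (simp add: take_Suc_conv_app_nth)
  also have "\<dots> \<le> n"
    using sum_list_take_mono[of "Suc k" "length \<alpha>" \<alpha>] k n by simp
  finally have le: "?s + \<alpha> ! k \<le> n" .
  have "B $$ (?s + i, ?s + j) = A $$ (?s + i, ?s + j)" if ij: "i < \<alpha> ! k" "j < \<alpha> ! k" for i j
  proof -
    have "?s + \<alpha> ! k - 1 < n" "?s + i \<le> ?s + \<alpha> ! k - 1" "?s + j \<le> ?s + \<alpha> ! k - 1"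
      using le ij by auto
    then show ?thesis
      using refines_agree[OF ref separated_jordan_block[OF k J refl]] by simp
  qed
  then show ?thesis unfolding diagonal_block_def Let_def by (intro eq_matI) auto
qed

section \<open>The partition by diagonal values\<close>

text \<open>Indices in distinct classes have different diagonal entries, so the entry between them
  vanishes: above the diagonal by \<open>sep\<close>, below it by triangularity.\<close>

lemma jordan_semicanonicalI:
  assumes M: "M \<in> carrier (parabolic_algebra \<alpha>)" and ut: "upper_triangular M"
    and J: "\<And>k. k < length \<alpha> \<Longrightarrow> in_jordan_form (diagonal_block \<alpha> M k)"
    and sep: "\<And>a b. a < b \<Longrightarrow> b < sum_list \<alpha> \<Longrightarrow> M $$ (a, a) \<noteq> M $$ (b, b) \<Longrightarrow> M $$ (a, b) = 0"
  shows "jordan_semicanonical \<alpha> M"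
proof -
  let ?n = "sum_list \<alpha>"
  define E where "E c = {a \<in> {0..<?n}. M $$ (a, a) = c}" for c
  \<comment> \<open>Only values occurring on the diagonal index a class, so no class is
    empty.\<close>
  let ?A = "E ` (\<lambda>a. M $$ (a, a)) ` {0..<?n}"
  have dim: "dim_row M = ?n" using M by (auto simp: parabolic_algebra_def)
  have "partition_on {0..<?n} ?A"
    by (rule partition_onI) (auto simp: E_def disjnt_def)
  moreover have "M $$ (a, b) = 0" if "a < ?n" "b < ?n" "M $$ (a, a) \<noteq> M $$ (b, b)" for a b
    using that sep[of a b] upper_triangularD[OF ut, of b a] dim by (cases a b rule: linorder_cases) auto
  then have "\<forall>a \<in> E c. \<forall>a' \<in> E c'. M $$ (a, a') = 0" if "E c \<noteq> E c'" for c c'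
    using that unfolding E_def by (cases "c = c'") simp_all
  then have "\<forall>A \<in> ?A. \<forall>A' \<in> ?A. A \<noteq> A' \<longrightarrow> (\<forall>a \<in> A. \<forall>a' \<in> A'. M $$ (a, a') = 0)"
    by blast
  moreover have "M $$ (a, a) = M $$ (a', a')" if "a \<in> E c" "a' \<in> E c" for a a' c
    using that by (simp add: E_def)
  then have "\<forall>A \<in> ?A. \<forall>A' \<in> ?A. \<forall>a \<in> A. \<forall>a' \<in> A'. M $$ (a, a) \<noteq> M $$ (a', a') \<longrightarrow> A \<noteq> A'"
    by blast
  ultimately show ?thesis using M J unfolding jordan_semicanonical_def by blast
qed

section \<open>Units of the algebra and the final conjugation\<close>

lemma carrier_parabolic_algebra:
  "M \<in> carrier (parabolic_algebra \<alpha>) \<longleftrightarrow>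
    M \<in> carrier_mat (sum_list \<alpha>) (sum_list \<alpha>) \<and> staircase (partial_sums \<alpha>) M"
  using block_upper_triangular_iff by (auto simp: parabolic_algebra_def)

text \<open>The inverse in the algebra is a definite description, resolved by the uniqueness
  computation \<open>Y = Q * P * Y = Q\<close>. That \<open>Q\<close> lies in the algebra itself is
  what makes \<open>P\<close> a unit there.\<close>

lemma parabolic_algebra_inverse:
  assumes P: "P \<in> carrier (parabolic_algebra \<alpha>)" and Q: "Q \<in> carrier (parabolic_algebra \<alpha>)"
    and PQ: "P * Q = 1\<^sub>m (sum_list \<alpha>)" "Q * P = 1\<^sub>m (sum_list \<alpha>)"
  shows "P \<in> Units (parabolic_algebra \<alpha>)" and "inv\<^bsub>parabolic_algebra \<alpha>\<^esub> P = Q"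
proof -
  let ?R = "parabolic_algebra \<alpha>" and ?n = "sum_list \<alpha>"
  have ops: "x \<otimes>\<^bsub>?R\<^esub> y = x * y" "\<one>\<^bsub>?R\<^esub> = 1\<^sub>m ?n" for x y
    by (auto simp: parabolic_algebra_def ring_mat_def)
  show "P \<in> Units ?R" using assms by (auto simp: Units_def ops)
  have "Y = Q" if Y: "Y \<in> carrier ?R" "P * Y = 1\<^sub>m ?n" for Y
  proof -
    have c: "P \<in> carrier_mat ?n ?n" "Q \<in> carrier_mat ?n ?n" "Y \<in> carrier_mat ?n ?n"
      using P Q Y by (auto simp: carrier_parabolic_algebra)
    have "Y = (Q * P) * Y" using c PQ by simp
    also have "\<dots> = Q * (P * Y)" using c by simp
    also have "\<dots> = Q" using c Y by simp
    finally show ?thesis .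
  qed
  then show "inv\<^bsub>?R\<^esub> P = Q"
    unfolding m_inv_def ops using Q PQ by (intro the_equality) blast+
qed

theorem theorem3p2:
  fixes n :: nat and \<alpha> :: "nat list" and r :: "complex mat"
  assumes "composition \<alpha> n"
    and "r \<in> carrier (parabolic_algebra \<alpha>)"
  shows "\<exists>M \<in> {b * r * inv\<^bsub>parabolic_algebra \<alpha>\<^esub> b | b. b \<in> Units (parabolic_algebra \<alpha>)}.
           jordan_semicanonical \<alpha> M"
proof -
  let ?n = "sum_list \<alpha>" and ?T = "partial_sums \<alpha>"
  have r: "r \<in> carrier_mat ?n ?n" "staircase ?T r"
    using assms(2) by (auto simp: carrier_parabolic_algebra)
  obtain A P1 Q1 where s1: "similar_mat_wit A r P1 Q1" and st1: "staircase ?T P1" "staircase ?T Q1"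
    and A: "upper_triangular A" and J: "\<And>k. k < length \<alpha> \<Longrightarrow> in_jordan_form (diagonal_block \<alpha> A k)"
    using jordan_diagonal_blocks[OF r] by blast
  have c1: "A \<in> carrier_mat ?n ?n" "P1 \<in> carrier_mat ?n ?n" "Q1 \<in> carrier_mat ?n ?n"
    using similar_mat_witD2[OF r(1) similar_mat_wit_sym[OF s1]] by auto
  obtain M where MA: "refines ?n M A"
    and sep: "\<And>a b. a < b \<Longrightarrow> b < ?n \<Longrightarrow> M $$ (a, a) \<noteq> M $$ (b, b) \<Longrightarrow> M $$ (a, b) = 0"
    using refines_separated[OF c1(1) A order_refl] by blast
  obtain P2 Q2 where s2: "similar_mat_wit M A P2 Q2"
    and ut: "upper_triangular P2" "upper_triangular Q2"
    using refines_similar[OF MA] .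
  have Mc: "M \<in> carrier_mat ?n ?n" and Mu: "upper_triangular M"
    using refines_carrier[OF MA] refines_upper_triangular[OF MA] by auto
  have c2: "P2 \<in> carrier_mat ?n ?n" "Q2 \<in> carrier_mat ?n ?n"
    using similar_mat_witD2[OF Mc s2] by auto
  \<comment> \<open>Upper triangularity is the staircase condition at all thresholds, in particular
    at the block boundaries; so the second conjugation also takes place inside the algebra.\<close>
  have st2: "staircase ?T P2" "staircase ?T Q2" "staircase ?T M"
    using ut Mu staircase_mono[OF _ subset_UNIV] by (auto simp: staircase_UNIV)
  \<comment> \<open>The two conjugations compose: \<open>M = P2 * A * Q2\<close> and
    \<open>A = P1 * r * Q1\<close>.\<close>
  let ?P = "P2 * P1" and ?Q = "Q1 * Q2"
  have P: "?P \<in> carrier (parabolic_algebra \<alpha>)" and Q: "?Q \<in> carrier (parabolic_algebra \<alpha>)"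
    using staircase_mult[OF c2(1) st2(1) c1(2) st1(1)] staircase_mult[OF c1(3) st1(2) c2(2) st2(2)]
      c1 c2 by (simp_all add: carrier_parabolic_algebra)
  from similar_mat_witD2[OF Mc similar_mat_wit_trans[OF s2 s1]]
  have PQ: "?P * ?Q = 1\<^sub>m ?n" "?Q * ?P = 1\<^sub>m ?n" and M: "M = ?P * r * ?Q" by auto
  have "jordan_semicanonical \<alpha> M"
  proof (rule jordan_semicanonicalI)
    show "M \<in> carrier (parabolic_algebra \<alpha>)"
      using Mc st2(3) by (simp add: carrier_parabolic_algebra)
    show "in_jordan_form (diagonal_block \<alpha> M k)" if "k < length \<alpha>" for k
      using diagonal_block_refines[OF MA refl that] J[OF that] by simp
  qed (use Mu sep in auto)
  moreover have "M = ?P * r * inv\<^bsub>parabolic_algebra \<alpha>\<^esub> ?P"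
    using M parabolic_algebra_inverse(2)[OF P Q PQ] by simp
  ultimately show ?thesis
    using parabolic_algebra_inverse(1)[OF P Q PQ] by (intro bexI CollectI exI conjI)
qed

end
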